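(* Let $E\subset\mathbb{C}$ be a straight line which is not vertical (for example $E=\mathbb{R}$). Then the family $X(E)$ of uniform limits on $E$ of sequences of Dirichlet polynomials coincides with the set of (restrictions to $E$ of) Dirichlet polynomials.
   Context: A Dirichlet polynomial is a function $P(s)=\sum_{n=1}^{N}a_n\frac{1}{n^s}$ with $N\in\mathbb{N}$, $a_n\in\mathbb{C}$. A line is vertical if it is parallel to the imaginary axis. Uniform convergence is with respect to the Euclidean distance on $\mathbb{C}$. *)

theory Defs
  imports "HOL-Analysis.Analysis"
begin

definition dirichlet_polynomials :: "(complex \<Rightarrow> complex) set" where
  "dirichlet_polynomials =
     {P. \<exists>(N::nat) (a :: nat \<Rightarrow> complex).
           P = (\<lambda>s. \<Sum>n=1..N. a n * (1 / of_nat n powr s))}"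

definition vertical_line :: "complex set \<Rightarrow> bool" where
  "vertical_line E \<longleftrightarrow> affine_parallel E {z. Re z = 0}"

text \<open>
  A function on \<open>E\<close> is represented by its extension that is \<open>undefined\<close> off \<open>E\<close>, so that
  equality of such representatives is equality on \<open>E\<close>.
\<close>

definition dirichlet_uniform_limits :: "complex set \<Rightarrow> (complex \<Rightarrow> complex) set" where
  "dirichlet_uniform_limits E =
     {f \<in> extensional E. \<exists>P :: nat \<Rightarrow> complex \<Rightarrow> complex.
        (\<forall>k. P k \<in> dirichlet_polynomials) \<and> uniform_limit E P f sequentially}"

end

theory Submission
  imports Defs
begin

text \<open>
  The theorem rests on a rigidity property: a Dirichlet polynomial that is bounded on a
  non-vertical line is constant (\<open>dirichlet_polynomial_bounded_imp_const\<close>). Such a line contains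
  a ray along which \<open>Re s\<close> tends to \<open>-\<infinity>\<close>, and there \<open>1 / n powr s\<close> has modulus
  \<open>n powr (- Re s)\<close>. So the term with the largest index \<open>M\<close> of nonzero coefficient dominates all
  the others, and it is unbounded if \<open>M \<ge> 2\<close>.

  If Dirichlet polynomials \<open>P k\<close> converge uniformly on the line, then from some \<open>K\<close> on the
  differences \<open>P k - P K\<close> are bounded there, hence constants \<open>c k\<close>. The constants converge because
  the \<open>P k\<close> converge at one point, and the limit function is \<open>P K\<close> plus \<open>lim c k\<close>, which is again
  a Dirichlet polynomial.
\<close>

section \<open>The vector space of Dirichlet polynomials\<close>

text \<open>Padding with zero coefficients lets two Dirichlet polynomials share one length.\<close>

lemma dirichlet_polynomial_pad:
  fixes P :: "complex \<Rightarrow> complex"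
  assumes "P = (\<lambda>s. \<Sum>n=1..N. a n * (1 / of_nat n powr s))" and "N \<le> M"
  shows "P = (\<lambda>s. \<Sum>n=1..M. (if n \<le> N then a n else 0) * (1 / of_nat n powr s))"
proof
  fix s :: complex
  have "(\<Sum>n=1..N. a n * (1 / of_nat n powr s))
      = (\<Sum>n=1..M. (if n \<le> N then a n else 0) * (1 / of_nat n powr s))"
    by (rule sum.mono_neutral_cong_left) (use assms(2) in auto)
  then show "P s = (\<Sum>n=1..M. (if n \<le> N then a n else 0) * (1 / of_nat n powr s))"
    using assms(1) by simp
qed

lemma dirichlet_polynomial_lincomb:
  assumes "P \<in> dirichlet_polynomials" and "Q \<in> dirichlet_polynomials"
  shows "(\<lambda>s. P s + c * Q s) \<in> dirichlet_polynomials"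
proof -
  obtain N a where P: "P = (\<lambda>s. \<Sum>n=1..N. a n * (1 / of_nat n powr s))"
    using assms(1) unfolding dirichlet_polynomials_def by blast
  obtain M b where Q: "Q = (\<lambda>s. \<Sum>n=1..M. b n * (1 / of_nat n powr s))"
    using assms(2) unfolding dirichlet_polynomials_def by blast
  define L where "L = max N M"
  define a' where "a' n = (if n \<le> N then a n else 0)" for n
  define b' where "b' n = (if n \<le> M then b n else 0)" for n
  have P': "P s = (\<Sum>n=1..L. a' n * (1 / of_nat n powr s))" for s
    using fun_cong[OF dirichlet_polynomial_pad[OF P, of L]] by (simp add: L_def a'_def)
  have Q': "Q s = (\<Sum>n=1..L. b' n * (1 / of_nat n powr s))" for s
    using fun_cong[OF dirichlet_polynomial_pad[OF Q, of L]] by (simp add: L_def b'_def)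
  have "(\<lambda>s. P s + c * Q s) = (\<lambda>s. \<Sum>n=1..L. (a' n + c * b' n) * (1 / of_nat n powr s))"
    unfolding P' Q' by (simp only: sum_distrib_left sum.distrib distrib_right mult.assoc)
  then show ?thesis
    unfolding dirichlet_polynomials_def by (intro CollectI exI)
qed

lemma dirichlet_polynomial_const: "(\<lambda>s. c) \<in> dirichlet_polynomials"
proof -
  have "(\<lambda>s. c) = (\<lambda>s::complex. \<Sum>n=1..1. c * (1 / of_nat n powr s))"
    by simp
  then show ?thesis
    unfolding dirichlet_polynomials_def by (intro CollectI exI)
qed

section \<open>Rigidity on non-vertical lines\<close>

text \<open>
  A line on which \<open>Re\<close> is constant lies in a vertical line and equals it by dimension. So \<open>Re\<close>
  takes two values on \<open>E\<close>, and the direction vector can be scaled to have real part \<open>-1\<close>.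
\<close>

lemma nonvertical_line_direction:
  assumes "affine E" and "aff_dim E = 1" and "\<not> vertical_line E"
  obtains p q where "Re q = -1" and "\<And>t::real. p + of_real t * q \<in> E"
proof -
  have "E \<noteq> {}"
    using assms(2) by auto
  then obtain p where p: "p \<in> E" by blast
  have "\<exists>r\<in>E. Re r \<noteq> Re p"
  proof (rule ccontr)
    assume "\<not> ?thesis"
    then have sub: "E \<subseteq> {z. 1 \<bullet> z = Re p}"
      by (auto simp: inner_complex_def)
    have aff: "affine {z::complex. 1 \<bullet> z = Re p}"
      by (rule affine_hyperplane)
    have dim: "aff_dim {z::complex. 1 \<bullet> z = Re p} = 1"
      by (subst aff_dim_hyperplane) auto
    have "E = {z. 1 \<bullet> z = Re p}"
      using affine_dim_equal[OF assms(1) aff _ sub] \<open>E \<noteq> {}\<close> dim assms(2) by simp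
    then have E: "E = {z. Re z = Re p}"
      by (simp add: inner_complex_def)
    have "{z. Re z = 0} = (\<lambda>z. - of_real (Re p) + z) ` E"
    proof (intro equalityI subsetI)
      fix z assume "z \<in> {z. Re z = 0}"
      then have "z = - of_real (Re p) + (of_real (Re p) + z)" "of_real (Re p) + z \<in> E"
        by (auto simp: E)
      then show "z \<in> (\<lambda>z. - of_real (Re p) + z) ` E"
        by (rule image_eqI)
    qed (auto simp: E)
    then show False
      using assms(3) unfolding vertical_line_def affine_parallel_def by blast
  qed
  then obtain r where r: "r \<in> E" "Re r \<noteq> Re p" by blast
  define q where "q = of_real (1 / (Re p - Re r)) * (r - p)"
  show ?thesis
  proof
    have "Re q = (Re r - Re p) / (Re p - Re r)"
      by (simp add: q_def)
    also have "\<dots> = -1"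
      using r(2) by (simp add: field_simps)
    finally show "Re q = -1" .
    fix t :: real
    define u where "u = t / (Re p - Re r)"
    have "(1 - u) *\<^sub>R p + u *\<^sub>R r \<in> E"
      using assms(1) p r(1) by (simp add: affine_alt)
    moreover have "of_real t * q = of_real u * (r - p)"
      by (simp add: q_def u_def)
    then have "(1 - u) *\<^sub>R p + u *\<^sub>R r = p + of_real t * q"
      by (simp add: scaleR_conv_of_real algebra_simps)
    ultimately show "p + of_real t * q \<in> E" by simp
  qed
qed

lemma norm_of_nat_powr: "norm (of_nat n powr s :: complex) = real n powr Re s"
  by (subst norm_powr_real_powr) auto

text \<open>
  Multiplying by \<open>M powr s\<close>, with \<open>M\<close> the top index of nonzero coefficient, isolates that
  coefficient: along the ray \<open>p + t * q\<close>, \<open>t \<rightarrow> \<infinity>\<close>, the other terms carry the factor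
  \<open>(M / n) powr Re s\<close>, which tends to \<open>0\<close>. If \<open>M \<ge> 2\<close>, then \<open>M powr s\<close> tends to \<open>0\<close> too, so
  boundedness would make the coefficient vanish.
\<close>

lemma dirichlet_polynomial_bounded_imp_const:
  fixes p q :: complex
  assumes "P \<in> dirichlet_polynomials" and q: "Re q = -1"
    and bdd: "\<And>t::real. norm (P (p + of_real t * q)) \<le> B"
  shows "\<exists>c. \<forall>s. P s = c"
proof -
  obtain N a where P: "P = (\<lambda>s. \<Sum>n=1..N. a n * (1 / of_nat n powr s))"
    using assms(1) unfolding dirichlet_polynomials_def by blast
  define A where "A = {n \<in> {2..N}. a n \<noteq> 0}"
  have "A = {}"
  proof (rule ccontr)
    assume "A \<noteq> {}"
    define M where "M = Max A"
    have "finite A" by (simp add: A_def)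
    then have "M \<in> A"
      using \<open>A \<noteq> {}\<close> unfolding M_def by (rule Max_in)
    then have M: "2 \<le> M" "M \<le> N" "a M \<noteq> 0"
      by (auto simp: A_def)
    have top: "a n = 0" if "M < n" "n \<le> N" for n
    proof (rule ccontr)
      assume "a n \<noteq> 0"
      then have "n \<in> A" using that M(1) by (auto simp: A_def)
      then show False using Max_ge[OF \<open>finite A\<close>] that(1) unfolding M_def by force
    qed
    define s where "s t = p + of_real t * q" for t :: real
    have Re_s: "Re (s t) = Re p - t" for t
      by (simp add: s_def q)
    have decay: "((\<lambda>t. x powr Re (s t)) \<longlongrightarrow> 0) at_top" if "1 < x" for x :: real
    proof -
      have "LIM t at_top. - Re p + t :> at_top"
        by (rule filterlim_tendsto_add_at_top[OF tendsto_const filterlim_ident])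
      then have "LIM t at_top. Re (s t) :> at_bot"
        by (simp add: filterlim_uminus_at_bot Re_s)
      then have "LIM t at_top. ln x * Re (s t) :> at_bot"
        using filterlim_tendsto_pos_mult_at_bot[OF tendsto_const[of "ln x"]] that by simp
      then have "((\<lambda>t. exp (ln x * Re (s t))) \<longlongrightarrow> 0) at_top"
        by (rule filterlim_compose[OF exp_at_bot])
      then show ?thesis
        using that by (simp add: powr_def mult.commute)
    qed
    have term_lim:
      "((\<lambda>t. of_nat M powr s t * (a n * (1 / of_nat n powr s t)))
          \<longlongrightarrow> (if n = M then a M else 0)) at_top" if n: "n \<in> {1..N}" for n
    proof (cases n M rule: linorder_cases)
      case less
      have "((\<lambda>t. norm (a n) * (real M / real n) powr Re (s t)) \<longlongrightarrow> 0) at_top"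
        by (rule tendsto_mult_right_zero[OF decay]) (use less n in simp)
      moreover have "norm (of_nat M powr s t * (a n * (1 / of_nat n powr s t)))
          = norm (a n) * (real M / real n) powr Re (s t)" for t
        by (simp add: norm_mult norm_divide norm_of_nat_powr powr_divide)
      ultimately have "((\<lambda>t. norm (of_nat M powr s t * (a n * (1 / of_nat n powr s t)))) \<longlongrightarrow> 0) at_top"
        by (simp only:)
      then show ?thesis
        using less tendsto_norm_zero_cancel by auto
    next
      case equal
      then show ?thesis using M(1) by simp
    next
      case greater
      then show ?thesis using top[of n] n by simp
    qed
    have "((\<lambda>t. of_nat M powr s t * P (s t))
        \<longlongrightarrow> (\<Sum>n=1..N. if n = M then a M else 0)) at_top"
      unfolding P sum_distrib_left by (intro tendsto_sum term_lim)
    then have lim: "((\<lambda>t. of_nat M powr s t * P (s t)) \<longlongrightarrow> a M) at_top"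
      using M by simp
    have "((\<lambda>t. of_nat M powr s t * P (s t)) \<longlongrightarrow> 0) at_top"
    proof (rule Lim_null_comparison)
      show "((\<lambda>t. real M powr Re (s t) * B) \<longlongrightarrow> 0) at_top"
        by (rule tendsto_mult_left_zero[OF decay]) (use M(1) in simp)
      have "norm (of_nat M powr s t * P (s t)) \<le> real M powr Re (s t) * B" for t
        using bdd[of t] by (simp add: norm_mult norm_of_nat_powr s_def mult_left_mono)
      then show "\<forall>\<^sub>F t in at_top. norm (of_nat M powr s t * P (s t)) \<le> real M powr Re (s t) * B"
        by simp
    qed
    then show False
      using tendsto_unique[OF _ lim] M(3) by simp
  qed
  then have zero: "a n = 0" if "n \<in> {2..N}" for n
    using that by (auto simp: A_def)
  have "P s = (\<Sum>n=1..N. if n = 1 then a 1 else 0)" for s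
    unfolding P using zero by (intro sum.cong) auto
  then show ?thesis by blast
qed

section \<open>Uniform limits\<close>

theorem mainTheorem12:
  fixes E :: "complex set"
  assumes "affine E" and "aff_dim E = 1" and "\<not> vertical_line E"
  shows "dirichlet_uniform_limits E = (\<lambda>P. restrict P E) ` dirichlet_polynomials"
proof (intro equalityI subsetI)
  fix f assume "f \<in> dirichlet_uniform_limits E"
  then obtain P where f: "f \<in> extensional E" and P: "\<And>k::nat. P k \<in> dirichlet_polynomials"
    and lim: "uniform_limit E P f sequentially"
    unfolding dirichlet_uniform_limits_def by blast
  obtain p q where q: "Re q = -1" and line: "\<And>t::real. p + of_real t * q \<in> E"
    using nonvertical_line_direction[OF assms] by blast
  obtain K where K: "\<And>k x. k \<ge> K \<Longrightarrow> x \<in> E \<Longrightarrow> dist (P k x) (f x) < 1"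
    using uniform_limitD[OF lim, of 1] unfolding eventually_sequentially by auto
  have "\<exists>c. \<forall>s. P k s + (-1) * P K s = c" if "k \<ge> K" for k
  proof (rule dirichlet_polynomial_bounded_imp_const[OF _ q])
    show "(\<lambda>s. P k s + (-1) * P K s) \<in> dirichlet_polynomials"
      by (intro dirichlet_polynomial_lincomb P)
    show "norm (P k (p + of_real t * q) + (-1) * P K (p + of_real t * q)) \<le> 2" for t
      using K[OF that line[of t]] K[OF order_refl line[of t]]
        dist_triangle_less_add[of "P k (p + of_real t * q)" "f (p + of_real t * q)" 1
          "P K (p + of_real t * q)" 1]
      by (simp add: dist_norm norm_minus_commute)
  qed
  then obtain c where c: "\<And>k s. k \<ge> K \<Longrightarrow> P k s + (-1) * P K s = c k"
    by metis
  have c_lim: "c \<longlonglongrightarrow> f x - P K x" if "x \<in> E" for x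
  proof (rule Lim_transform_eventually)
    show "(\<lambda>k. P k x - P K x) \<longlonglongrightarrow> f x - P K x"
      by (intro tendsto_diff tendsto_const tendsto_uniform_limitI[OF lim that])
    show "\<forall>\<^sub>F k in sequentially. P k x - P K x = c k"
      using eventually_ge_at_top[of K] by eventually_elim (use c[of _ x] in simp)
  qed
  have "f x = P K x + 1 * lim c" if "x \<in> E" for x
    using limI[OF c_lim[OF that]] by simp
  then have "f = restrict (\<lambda>s. P K s + 1 * lim c) E"
    by (intro extensionalityI[OF f restrict_extensional]) simp
  moreover have "(\<lambda>s. P K s + 1 * lim c) \<in> dirichlet_polynomials"
    by (intro dirichlet_polynomial_lincomb P dirichlet_polynomial_const)
  ultimately show "f \<in> (\<lambda>P. restrict P E) ` dirichlet_polynomials"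
    by blast
next
  fix f assume "f \<in> (\<lambda>P. restrict P E) ` dirichlet_polynomials"
  then obtain P where P: "P \<in> dirichlet_polynomials" and f: "f = restrict P E"
    by blast
  have "uniform_limit E (\<lambda>k. P) f sequentially"
    by (rule uniform_limitI) (simp add: f)
  then show "f \<in> dirichlet_uniform_limits E"
    unfolding dirichlet_uniform_limits_def using P f by auto
qed

end
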